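(* Let $\Gamma=G(\mathbb{Z}_n,\mathcal{C})$ be a connected oriented circulant graph of prime order $n$. Then there is no zero transfer in $\Gamma$, i.e. there are no two distinct vertices $u,v$ of $\Gamma$ with zero transfer between them.
   Context: For $\mathcal{C}\subseteq\mathbb{Z}_n\setminus\{0\}$, the circulant graph $G(\mathbb{Z}_n,\mathcal{C})$ has vertex set $\mathbb{Z}_n$ and arc set $\{(a,b): b-a\in\mathcal{C},\ a,b\in\mathbb{Z}_n\}$; it is an oriented circulant graph if $\mathcal{C}\cap\mathcal{C}^{-1}=\emptyset$, where $\mathcal{C}^{-1}=\{-c: c\in\mathcal{C}\}$. Connected means that the underlying undirected graph is connected. Its Hermitian adjacency matrix $H$ has $H_{a,b}=\mathrm{i}$ if $b-a\in\mathcal{C}$, $H_{a,b}=-\mathrm{i}$ if $a-b\in\mathcal{C}$, and $H_{a,b}=0$ otherwise, where $\mathrm{i}=\sqrt{-1}$. The transition matrix is $U(t)=\exp(-\mathrm{i}tH)$, $t\in\mathbb{R}$. There is zero transfer between vertices $u$ and $v$ if $U(t)_{u,v}=0$ for all $t\ge 0$ (this condition is symmetric in $u$ and $v$). *)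

theory Defs
  imports
    "HOL-Computational_Algebra.Primes"
    "Jordan_Normal_Form.Matrix"
    "Graph_Theory.Digraph_Component"
begin

text \<open>Elements of Z_n are represented by their least residues in \<open>{0..<n}\<close>, so that they can serve
  directly as row and column indices of matrices; \<open>zdiff n b a\<close> is the difference b - a in Z_n.\<close>

definition zdiff :: "nat \<Rightarrow> nat \<Rightarrow> nat \<Rightarrow> nat" where
  "zdiff n b a = nat ((int b - int a) mod int n)"

definition circulant_graph :: "nat \<Rightarrow> nat set \<Rightarrow> nat pair_pre_digraph" where
  "circulant_graph n C =
     \<lparr> pverts = {0..<n}, parcs = {(a, b). a \<in> {0..<n} \<and> b \<in> {0..<n} \<and> zdiff n b a \<in> C} \<rparr>"

definition oriented_connection_set :: "nat \<Rightarrow> nat set \<Rightarrow> bool" where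
  "oriented_connection_set n C \<longleftrightarrow> C \<subseteq> {0..<n} - {0} \<and> C \<inter> (\<lambda>c. zdiff n 0 c) ` C = {}"

definition hermitian_adj :: "nat \<Rightarrow> nat set \<Rightarrow> complex mat" where
  "hermitian_adj n C = mat n n (\<lambda>(a, b).
     if zdiff n b a \<in> C then \<i> else if zdiff n a b \<in> C then - \<i> else 0)"

text \<open>The exponential of a square matrix as its power series, summed entrywise; every entry
  converges by \<open>summable_mat_exp\<close> below.\<close>

definition mat_exp :: "complex mat \<Rightarrow> complex mat" where
  "mat_exp A = mat (dim_row A) (dim_row A) (\<lambda>(i, j). \<Sum>k. (A ^\<^sub>m k) $$ (i, j) / fact k)"

lemma summable_mat_exp:
  fixes A :: "complex mat"
  assumes A: "A \<in> carrier_mat n n" and ij: "i < n" "j < n"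
  shows "summable (\<lambda>k. (A ^\<^sub>m k) $$ (i, j) / fact k)"
proof -
  define M where "M = (\<Sum>p\<in>{0..<n} \<times> {0..<n}. cmod (A $$ p))"
  have M0: "0 \<le> M" unfolding M_def by (intro sum_nonneg) auto
  have M: "cmod (A $$ (a, b)) \<le> M" if "a < n" "b < n" for a b
    unfolding M_def using that by (intro member_le_sum) auto
  have bound: "cmod ((A ^\<^sub>m k) $$ (a, b)) \<le> (real n * M) ^ k" if "a < n" "b < n" for a b k
    using that
  proof (induction k arbitrary: b)
    case 0
    then show ?case using A by (auto simp: one_mat_def)
  next
    case (Suc k)
    have c: "A ^\<^sub>m k \<in> carrier_mat n n" using A by (rule pow_carrier_mat)
    have "(A ^\<^sub>m Suc k) $$ (a, b) = (\<Sum>l\<in>{0..<n}. (A ^\<^sub>m k) $$ (a, l) * A $$ (l, b))"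
      using Suc.prems A c by (simp add: scalar_prod_def)
    also have "cmod \<dots> \<le> (\<Sum>l\<in>{0..<n}. (real n * M) ^ k * M)"
      using Suc M M0 by (intro sum_norm_le) (auto simp: norm_mult intro!: mult_mono)
    also have "\<dots> = (real n * M) ^ Suc k" by simp
    finally show ?case .
  qed
  show ?thesis
  proof (rule summable_comparison_test')
    show "summable (\<lambda>k. inverse (fact k) * (real n * M) ^ k)" by (rule summable_exp)
    show "norm ((A ^\<^sub>m k) $$ (i, j) / fact k) \<le> inverse (fact k) * (real n * M) ^ k"
      if "k \<ge> 0" for k
      using bound[OF ij, of k] by (simp add: norm_divide field_simps)
  qed
qed

definition transition_matrix :: "nat \<Rightarrow> nat set \<Rightarrow> real \<Rightarrow> complex mat" where
  "transition_matrix n C t = mat_exp ((- \<i> * complex_of_real t) \<cdot>\<^sub>m hermitian_adj n C)"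

definition zero_transfer :: "nat \<Rightarrow> nat set \<Rightarrow> nat \<Rightarrow> nat \<Rightarrow> bool" where
  "zero_transfer n C u v \<longleftrightarrow> (\<forall>t\<ge>0. transition_matrix n C t $$ (u, v) = 0)"

end

(* Zero transfer between u and v means that the (u,v) entries of all powers of H vanish. In terms of the
   eigenvalues mu_j of the circulant matrix H and a primitive n-th root of unity w, this reads
   sum_j mu_j^k w^(j(u-v)) = 0 for all k, so the sum of w^(j(u-v)) over each class of indices with a
   common eigenvalue vanishes. For prime n, a nonempty sum of distinct powers j < n of an n-th root of unity
   vanishes only if all n powers occur. Hence H has a single eigenvalue, so it is a scalar matrix and
   the graph has no arcs. *)
theory Submission
  imports Defs "Jordan_Normal_Form.Char_Poly"
begin

section \<open>Integer polynomials in roots of unity are algebraic integers\<close>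

text \<open>An eigenvalue is a root of the characteristic polynomial, which for an integer matrix is
  monic with integer coefficients.\<close>

lemma algebraic_int_eigenvalue:
  fixes A :: "int mat" and \<alpha> :: complex
  assumes A: "A \<in> carrier_mat n n" and eig: "eigenvalue (map_mat of_int A) \<alpha>"
  shows "algebraic_int \<alpha>"
proof -
  have "map_mat of_int A \<in> carrier_mat n n" using A by simp
  then have "poly (char_poly (map_mat of_int A)) \<alpha> = 0"
    using eig eigenvalue_root_char_poly by blast
  then have "poly (map_poly of_int (char_poly A)) \<alpha> = 0"
    by (simp add: of_int_hom.char_poly_hom[OF A])
  moreover have "lead_coeff (char_poly A) = 1"
    using degree_monic_char_poly[OF A] by simp
  ultimately show ?thesis
    unfolding algebraic_int_altdef_ipoly by blast
qed

text \<open>By Horner's scheme it suffices that integer combinations of \<open>z ^ 0\<close>, ...,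
  \<open>z ^ (n - 1)\<close> are closed under multiplication by \<open>z\<close>, which permutes
  these powers cyclically.\<close>

lemma int_poly_root_of_unity_reduce:
  fixes h :: "int poly" and z :: complex
  assumes n: "n > 0" and z: "z ^ n = 1"
  obtains c :: "nat \<Rightarrow> int" where "poly (map_poly of_int h) z = (\<Sum>j<n. of_int (c j) * z ^ j)"
proof -
  obtain m where m: "n = Suc m" using n by (cases n) auto
  have "\<exists>c :: nat \<Rightarrow> int. poly (map_poly of_int h) z = (\<Sum>j<n. of_int (c j) * z ^ j)"
  proof (induction h)
    case 0
    show ?case by (rule exI[of _ "\<lambda>_. 0"]) simp
  next
    case (pCons a h)
    then obtain c :: "nat \<Rightarrow> int" where c: "poly (map_poly of_int h) z = (\<Sum>j<n. of_int (c j) * z ^ j)"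
      by blast
    \<comment> \<open>Coefficients move up one place; the top one, \<open>c m\<close>, wraps round
      to the constant term because \<open>z ^ Suc m = 1\<close>.\<close>
    define c' where "c' j = (case j of 0 \<Rightarrow> c m + a | Suc i \<Rightarrow> c i)" for j
    have "(\<Sum>j<n. of_int (c' j) * z ^ j) = of_int (c m + a) + (\<Sum>j<m. of_int (c j) * z ^ Suc j)"
      unfolding m sum.lessThan_Suc_shift by (simp add: c'_def)
    also have "\<dots> = of_int a + z * (\<Sum>j<n. of_int (c j) * z ^ j)"
      using z by (simp add: m sum_distrib_left algebra_simps)
    finally have "poly (map_poly of_int (pCons a h)) z = (\<Sum>j<n. of_int (c' j) * z ^ j)"
      using c by (simp add: of_int_hom.map_poly_pCons_hom)
    then show ?case by blast
  qed
  then show thesis using that by blast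
qed

text \<open>Multiplication by the given value acts on the powers of \<open>z\<close> through an
  integer matrix, with the vector of these powers as eigenvector.\<close>

lemma algebraic_int_poly_root_of_unity:
  fixes h :: "int poly" and z :: complex
  assumes n: "n > 0" and z: "z ^ n = 1"
  shows "algebraic_int (poly (map_poly of_int h) z)"
proof -
  define \<alpha> where "\<alpha> = poly (map_poly of_int h) z"
  have "\<exists>c :: nat \<Rightarrow> int. \<alpha> * z ^ i = (\<Sum>j<n. of_int (c j) * z ^ j)" for i
    using int_poly_root_of_unity_reduce[OF n z, of "monom 1 i * h"]
    by (simp add: of_int_poly_hom.hom_mult of_int_hom.map_poly_hom_monom poly_monom \<alpha>_def mult.commute) blast
  then obtain c :: "nat \<Rightarrow> nat \<Rightarrow> int" where c: "\<And>i. \<alpha> * z ^ i = (\<Sum>j<n. of_int (c i j) * z ^ j)"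
    by metis
  define A where "A = mat n n (\<lambda>(i, j). c i j)"
  define w where "w = vec n (\<lambda>j. z ^ j)"
  have A: "A \<in> carrier_mat n n" by (simp add: A_def)
  have "w $ 0 = 1" using n by (simp add: w_def)
  then have "w \<noteq> 0\<^sub>v n" using n by auto
  moreover have "map_mat of_int A *\<^sub>v w = \<alpha> \<cdot>\<^sub>v w"
    by (rule eq_vecI) (simp_all add: A_def w_def c scalar_prod_def lessThan_atLeast0)
  ultimately have "eigenvalue (map_mat of_int A) \<alpha>"
    using A by (auto simp: eigenvalue_def eigenvector_def w_def intro!: exI[of _ "vec n (\<lambda>j. z ^ j)"])
  then show ?thesis
    using algebraic_int_eigenvalue[OF A] by (simp add: \<alpha>_def)
qed

section \<open>Vanishing sums of roots of unity of prime order\<close>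

text \<open>All inner binomial coefficients are divisible by \<open>p\<close>. The application is to
  the ring of integer polynomials.\<close>

lemma prime_dvd_freshmans_dream:
  fixes x y :: "'a::comm_ring_1"
  assumes p: "prime p"
  shows "of_nat p dvd (x + y) ^ p - (x ^ p + y ^ p)"
proof -
  have p0: "p > 0" using p prime_gt_0_nat by blast
  have "(x + y) ^ p = (\<Sum>k\<le>p. of_nat (p choose k) * x ^ k * y ^ (p - k))"
    by (rule binomial_ring)
  also have "{..p} = insert 0 (insert p {0<..<p})" using p0 by auto
  also have "(\<Sum>k\<in>insert 0 (insert p {0<..<p}). of_nat (p choose k) * x ^ k * y ^ (p - k)) =
      x ^ p + y ^ p + (\<Sum>k\<in>{0<..<p}. of_nat (p choose k) * x ^ k * y ^ (p - k))"
    using p0 by (simp add: algebra_simps)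
  finally have "(x + y) ^ p - (x ^ p + y ^ p) =
      (\<Sum>k\<in>{0<..<p}. of_nat (p choose k) * x ^ k * y ^ (p - k))"
    by simp
  moreover have "of_nat p dvd (of_nat (p choose k) :: 'a)" if "k \<in> {0<..<p}" for k
    using dvd_choose_prime[of k p] that p by (auto simp: dvd_def)
  ultimately show ?thesis
    by (auto intro!: dvd_sum)
qed

text \<open>Modulo \<open>p\<close> one has \<open>(X - 1)\<^sup>p = X\<^sup>p - 1\<close>, which vanishes at \<open>z\<close>. Hence \<open>g 1 \<equiv> g z = 0\<close> modulo
  \<open>z - 1\<close> makes \<open>(g 1)\<^sup>p / p\<close> a rational algebraic integer.\<close>
lemma prime_dvd_poly_1_if_root_of_unity:
  fixes g :: "int poly" and z :: complex
  assumes p: "prime p" and z: "z ^ p = 1" and g: "poly (map_poly of_int g) z = 0"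
  shows "int p dvd poly g 1"
proof -
  have p0: "p > 0" using p prime_gt_0_nat by blast
  obtain q where q: "g - [:poly g 1:] = [:-1, 1:] * q"
  proof -
    have "poly (g - [:poly g 1:]) 1 = 0" by simp
    then show thesis using that unfolding poly_eq_0_iff_dvd dvd_def by blast
  qed
  have "poly (map_poly of_int (g - [:poly g 1:])) z = - of_int (poly g 1)"
    by (simp add: of_int_poly_hom.hom_minus g of_int_hom.map_poly_pCons_hom)
  then have gz: "- of_int (poly g 1) = (z - 1) * poly (map_poly of_int q) z"
    unfolding q of_int_poly_hom.hom_mult by (simp add: of_int_hom.map_poly_pCons_hom algebra_simps)
  have "of_nat p dvd ([:0, 1:] + (- 1)) ^ p - ([:0, 1:] ^ p + (- 1 :: int poly) ^ p)"
    by (rule prime_dvd_freshmans_dream[OF p])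
  then obtain r where r: "([:0, 1:] + (- 1)) ^ p - ([:0, 1:] ^ p + (- 1 :: int poly) ^ p) = of_nat p * r"
    unfolding dvd_def by blast
  \<comment> \<open>The constant left after \<open>z ^ p = 1\<close> is also a multiple of
    \<open>p\<close>: it is 2 if \<open>p = 2\<close>, and 0 if \<open>p\<close> is odd.\<close>
  obtain s :: int where s: "1 + (- 1) ^ p = int p * s"
  proof (cases "p = 2")
    case True
    then show thesis using that[of 1] by simp
  next
    case False
    then have "odd p" using p primes_dvd_imp_eq two_is_prime_nat by blast
    then show thesis using that[of 0] by simp
  qed
  have "poly (map_poly of_int (([:0, 1:] + (- 1)) ^ p - ([:0, 1:] ^ p + (- 1 :: int poly) ^ p))) z
      = (z - 1) ^ p - (z ^ p + (- 1) ^ p)"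
    by (simp add: of_int_poly_hom.hom_minus of_int_poly_hom.hom_add of_int_poly_hom.hom_power
        of_int_poly_hom.hom_uminus of_int_hom.map_poly_pCons_hom)
  then have "(z - 1) ^ p - (z ^ p + (- 1) ^ p) = of_nat p * poly (map_poly of_int r) z"
    unfolding r by (simp add: of_nat_poly of_int_hom.map_poly_hom_smult)
  moreover have "z ^ p + (- 1) ^ p = of_nat p * of_int s"
    using arg_cong[OF s, of "of_int :: int \<Rightarrow> complex"] z by simp
  ultimately have zp: "(z - 1) ^ p = of_nat p * (of_int s + poly (map_poly of_int r) z)"
    by (simp add: algebra_simps)
  \<comment> \<open>The cofactor of \<open>p\<close> when \<open>gz\<close> is raised to the power
    \<open>p\<close> and \<open>zp\<close> is substituted.\<close>
  define h where "h = ([:s:] + r) * q ^ p"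
  have h: "(- of_int (poly g 1)) ^ p = of_nat p * poly (map_poly of_int h) z"
    unfolding gz power_mult_distrib zp h_def
    by (simp add: of_int_poly_hom.hom_mult of_int_poly_hom.hom_add of_int_poly_hom.hom_power of_int_hom.map_poly_pCons_hom)
  then have "poly (map_poly of_int h) z = (- of_int (poly g 1)) ^ p / of_nat p"
    using p0 by simp
  also have "\<dots> \<in> \<rat>" by simp
  finally have "poly (map_poly of_int h) z \<in> \<int>"
    using algebraic_int_poly_root_of_unity[OF p0 z] rational_algebraic_int_is_int by blast
  then obtain m where "poly (map_poly of_int h) z = of_int m"
    by (elim Ints_cases)
  with h have "(of_int ((- poly g 1) ^ p) :: complex) = of_int (int p * m)" by simp
  then have "(- poly g 1) ^ p = int p * m"
    unfolding of_int_eq_iff .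
  then have "int p dvd (- poly g 1) ^ p" by simp
  then have "int p dvd - poly g 1"
    using p prime_dvd_power by (metis prime_nat_int_transfer)
  then show ?thesis by simp
qed

text \<open>The sum is the value at \<open>z\<close> of a polynomial \<open>g\<close> with
  coefficients 0 and 1, and \<open>g\<close> has value \<open>card S\<close> at 1. So
  \<open>p\<close> divides \<open>card S\<close>, which lies between 1 and \<open>p\<close>.\<close>

lemma vanishing_sum_roots_of_unity:
  fixes z :: complex
  assumes p: "prime p" and z: "z ^ p = 1" and S: "S \<subseteq> {..<p}" "S \<noteq> {}"
    and sum: "(\<Sum>j\<in>S. z ^ j) = 0"
  shows "S = {..<p}"
proof -
  have fin: "finite S" using S finite_subset by blast
  define g :: "int poly" where "g = (\<Sum>j\<in>S. monom 1 j)"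
  have "poly (map_poly of_int g) z = (\<Sum>j\<in>S. z ^ j)"
    by (simp add: g_def of_int_poly_hom.hom_sum of_int_hom.map_poly_hom_monom poly_sum poly_monom)
  then have "int p dvd poly g 1"
    using prime_dvd_poly_1_if_root_of_unity[OF p z] sum by simp
  then have "p dvd card S"
    by (simp add: g_def poly_sum poly_monom)
  then have "p \<le> card S"
    using S fin by (simp add: dvd_imp_le card_gt_0_iff)
  then show ?thesis
    using S by (simp add: card_seteq)
qed

section \<open>Fourier analysis of circulant matrices\<close>

lemma sum_powers_root_of_unity:
  fixes z :: complex
  assumes "z ^ n = 1" "z \<noteq> 1"
  shows "(\<Sum>j<n. z ^ j) = 0"
  using assms by (simp add: geometric_sum)

text \<open>Orthogonality of characters: after swapping the sums, the inner geometric sum is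
  \<open>n\<close> for \<open>b = v\<close> and 0 otherwise. Injectivity expresses that \<omega> is
  a primitive root.\<close>

lemma fourier_inversion:
  fixes \<omega> :: complex and f :: "nat \<Rightarrow> complex"
  assumes \<omega>: "\<omega> ^ n = 1" and inj: "inj_on (\<lambda>j. \<omega> ^ j) {..<n}" and v: "v < n"
  shows "(\<Sum>j<n. (\<Sum>b<n. f b * (\<omega> ^ j) ^ b) / (\<omega> ^ v) ^ j) = of_nat n * f v"
proof -
  have \<omega>0: "\<omega> \<noteq> 0" using \<omega> v by (auto simp: power_0_left)
  have inner: "(\<Sum>j<n. (\<omega> ^ b / \<omega> ^ v) ^ j) = (if b = v then of_nat n else 0)" if b: "b < n" for b
  proof (cases "b = v")
    case True
    then show ?thesis using \<omega>0 by simp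
  next
    case False
    then have "\<omega> ^ b \<noteq> \<omega> ^ v" using inj b v by (auto simp: inj_on_def)
    then have "\<omega> ^ b / \<omega> ^ v \<noteq> 1" using \<omega>0 by simp
    moreover have "(\<omega> ^ b / \<omega> ^ v) ^ n = 1"
      using \<omega> by (metis div_by_1 mult.commute power_divide power_mult power_one)
    ultimately show ?thesis using False sum_powers_root_of_unity by simp
  qed
  have "(\<Sum>j<n. (\<Sum>b<n. f b * (\<omega> ^ j) ^ b) / (\<omega> ^ v) ^ j) =
      (\<Sum>j<n. \<Sum>b<n. f b * (\<omega> ^ b / \<omega> ^ v) ^ j)"
    by (simp add: sum_divide_distrib power_divide mult.commute flip: power_mult)
  also have "\<dots> = (\<Sum>b<n. f b * (\<Sum>j<n. (\<omega> ^ b / \<omega> ^ v) ^ j))"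
    by (subst sum.swap) (simp add: sum_distrib_left)
  also have "\<dots> = (\<Sum>b<n. f b * (if b = v then of_nat n else 0))"
    using inner by (intro sum.cong) auto
  also have "\<dots> = of_nat n * f v"
    using v by (simp add: if_distrib cong: if_cong)
  finally show ?thesis .
qed

text \<open>The character with values \<open>z ^ b\<close> is an eigenvector of every circulant
  matrix, as the substitution \<open>b = a + d\<close> in Z_n shows.\<close>

lemma circulant_row_character:
  fixes A :: "complex mat" and h :: "nat \<Rightarrow> complex"
  assumes circ: "\<And>a b. a < n \<Longrightarrow> b < n \<Longrightarrow> A $$ (a, b) = h (zdiff n b a)"
    and z: "z ^ n = 1" and a: "a < n"
  shows "(\<Sum>b<n. A $$ (a, b) * z ^ b) = (\<Sum>d<n. h d * z ^ d) * z ^ a"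
proof -
  have mod: "z ^ (k mod n) = z ^ k" for k
  proof -
    have "z ^ k = z ^ (n * (k div n) + k mod n)" by simp
    also have "\<dots> = z ^ (k mod n)" unfolding power_add power_mult z by simp
    finally show ?thesis ..
  qed
  have zd: "zdiff n ((a + d) mod n) a = d" if "d < n" for d
    using that by (simp add: zdiff_def zmod_int mod_diff_left_eq)
  have az: "(a + zdiff n b a) mod n = b" if "b < n" for b
  proof -
    have "int ((a + zdiff n b a) mod n) = (int a + (int b - int a) mod int n) mod int n"
      using that by (simp add: zdiff_def zmod_int)
    also have "\<dots> = int b" using that by (simp add: mod_add_right_eq)
    finally show ?thesis by simp
  qed
  have "(\<Sum>b<n. A $$ (a, b) * z ^ b) = (\<Sum>d<n. h d * z ^ (a + d))"
  proof (rule sum.reindex_bij_witness[of _ "\<lambda>d. (a + d) mod n" "\<lambda>b. zdiff n b a"])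
    fix b assume b: "b \<in> {..<n}"
    then show "zdiff n b a \<in> {..<n}" by (simp add: zdiff_def nat_less_iff)
    show "(a + zdiff n b a) mod n = b" using az b by simp
    show "h (zdiff n b a) * z ^ (a + zdiff n b a) = A $$ (a, b) * z ^ b"
      using circ[OF a] b az[of b] mod[of "a + zdiff n b a"] by simp
  qed (use zd a in auto)
  then show ?thesis by (simp add: power_add sum_distrib_left mult_ac)
qed

lemma circulant_power_row_character:
  fixes A :: "complex mat" and h :: "nat \<Rightarrow> complex"
  assumes A: "A \<in> carrier_mat n n"
    and circ: "\<And>a b. a < n \<Longrightarrow> b < n \<Longrightarrow> A $$ (a, b) = h (zdiff n b a)"
    and z: "z ^ n = 1" and a: "a < n"
  shows "(\<Sum>b<n. (A ^\<^sub>m k) $$ (a, b) * z ^ b) = (\<Sum>d<n. h d * z ^ d) ^ k * z ^ a"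
proof (induction k)
  case 0
  have "(\<Sum>b<n. (A ^\<^sub>m 0) $$ (a, b) * z ^ b) = (\<Sum>b<n. if b = a then z ^ b else 0)"
    using A a by (intro sum.cong) auto
  then show ?case using a by simp
next
  case (Suc k)
  let ?\<mu> = "\<Sum>d<n. h d * z ^ d"
  have c: "A ^\<^sub>m k \<in> carrier_mat n n" using A by (rule pow_carrier_mat)
  have "(\<Sum>b<n. (A ^\<^sub>m Suc k) $$ (a, b) * z ^ b) =
      (\<Sum>b<n. (\<Sum>l<n. (A ^\<^sub>m k) $$ (a, l) * A $$ (l, b)) * z ^ b)"
    using A c a by (intro sum.cong) (auto simp: scalar_prod_def lessThan_atLeast0)
  also have "\<dots> = (\<Sum>l<n. (A ^\<^sub>m k) $$ (a, l) * (\<Sum>b<n. A $$ (l, b) * z ^ b))"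
    unfolding sum_distrib_right sum_distrib_left by (subst sum.swap) (simp add: mult_ac)
  also have "\<dots> = (\<Sum>l<n. (A ^\<^sub>m k) $$ (a, l) * (?\<mu> * z ^ l))"
    using circulant_row_character[OF circ z] by (intro sum.cong) auto
  also have "\<dots> = ?\<mu> * (\<Sum>l<n. (A ^\<^sub>m k) $$ (a, l) * z ^ l)"
    by (simp add: sum_distrib_left mult_ac)
  finally show ?case using Suc by (simp add: mult_ac)
qed

text \<open>By linearity the powers of \<open>f j\<close> may be replaced by any polynomial in
  \<open>f j\<close>; one that vanishes at all values of \<open>f\<close> except \<open>c\<close>
  isolates the class of \<open>c\<close>.\<close>

lemma separate_value_class:
  fixes f w :: "'a \<Rightarrow> 'b::field"
  assumes I: "finite I" and pow: "\<And>k. (\<Sum>j\<in>I. f j ^ k * w j) = 0"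
  shows "(\<Sum>j\<in>{j\<in>I. f j = c}. w j) = 0"
proof -
  define T where "T = f ` I - {c}"
  define q where "q = (\<Prod>\<theta>\<in>T. [:- \<theta>, 1:])"
  have T: "finite T" using I by (simp add: T_def)
  have q: "poly q x = 0 \<longleftrightarrow> x \<in> T" for x
    using T by (auto simp: q_def poly_prod)
  have "(\<Sum>j\<in>I. poly q (f j) * w j) = (\<Sum>k\<le>degree q. coeff q k * (\<Sum>j\<in>I. f j ^ k * w j))"
    unfolding poly_altdef sum_distrib_right sum_distrib_left by (subst sum.swap) (simp add: mult_ac)
  then have "(\<Sum>j\<in>I. poly q (f j) * w j) = 0" using pow by simp
  moreover have "(\<Sum>j\<in>I. poly q (f j) * w j) = (\<Sum>j\<in>{j\<in>I. f j = c}. poly q (f j) * w j)"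
    using I q by (intro sum.mono_neutral_right) (auto simp: T_def)
  moreover have "\<dots> = poly q c * (\<Sum>j\<in>{j\<in>I. f j = c}. w j)"
    by (simp add: sum_distrib_left)
  moreover have "poly q c \<noteq> 0" using q by (simp add: T_def)
  ultimately show ?thesis by simp
qed

text \<open>The Fourier transform of \<open>h\<close> lists the eigenvalues. Once they are all
  equal, inversion shows that \<open>h\<close> vanishes away from 0.\<close>

lemma circulant_prime_vanishing_powers_entry:
  fixes A :: "complex mat" and h :: "nat \<Rightarrow> complex"
  assumes p: "prime n" and A: "A \<in> carrier_mat n n"
    and circ: "\<And>a b. a < n \<Longrightarrow> b < n \<Longrightarrow> A $$ (a, b) = h (zdiff n b a)"
    and uv: "u < n" "v < n" "u \<noteq> v" and zero: "\<And>k. (A ^\<^sub>m k) $$ (u, v) = 0"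
    and d: "0 < d" "d < n"
  shows "h d = 0"
proof -
  have n0: "n > 0" using d(1,2) by linarith
  define \<omega> where "\<omega> = cis (2 * pi / real n)"
  have \<omega>j: "\<omega> ^ j = cis (2 * pi * real j / real n)" for j
    by (simp add: \<omega>_def DeMoivre mult_ac)
  have \<omega>: "\<omega> ^ n = 1" using n0 by (simp add: \<omega>j)
  have inj: "inj_on (\<lambda>j. \<omega> ^ j) {..<n}"
  proof -
    have "(\<lambda>j. \<omega> ^ j) = (\<lambda>j. cis (2 * pi * real j / real n))" by (rule ext) (rule \<omega>j)
    then show ?thesis using bij_betw_imp_inj_on[OF bij_betw_roots_unity[OF n0]] by (simp only:)
  qed
  have \<omega>0: "\<omega> \<noteq> 0" by (simp add: \<omega>_def)
  have \<omega>jn: "(\<omega> ^ j) ^ n = 1" for j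
  proof -
    have "(\<omega> ^ j) ^ n = (\<omega> ^ n) ^ j" by (simp add: mult.commute flip: power_mult)
    then show ?thesis using \<omega> by simp
  qed
  \<comment> \<open>The eigenvalue of \<open>A\<close> at the character with values
    \<open>(\<omega> ^ j) ^ b\<close>.\<close>
  define \<mu> where "\<mu> j = (\<Sum>d<n. h d * (\<omega> ^ j) ^ d)" for j
  define \<zeta> where "\<zeta> = \<omega> ^ u / \<omega> ^ v"
  have \<zeta>: "\<zeta> ^ n = 1" by (simp add: \<zeta>_def power_divide \<omega>jn)
  have "(\<Sum>j<n. \<mu> j ^ k * \<zeta> ^ j) = 0" for k
  proof -
    have "(\<Sum>j<n. \<mu> j ^ k * \<zeta> ^ j) =
        (\<Sum>j<n. (\<Sum>b<n. (A ^\<^sub>m k) $$ (u, b) * (\<omega> ^ j) ^ b) / (\<omega> ^ v) ^ j)"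
    proof (rule sum.cong)
      fix j
      have "(\<Sum>b<n. (A ^\<^sub>m k) $$ (u, b) * (\<omega> ^ j) ^ b) = \<mu> j ^ k * (\<omega> ^ j) ^ u"
        unfolding \<mu>_def by (rule circulant_power_row_character[where h = h, OF A circ \<omega>jn uv(1)])
      then show "\<mu> j ^ k * \<zeta> ^ j = (\<Sum>b<n. (A ^\<^sub>m k) $$ (u, b) * (\<omega> ^ j) ^ b) / (\<omega> ^ v) ^ j"
        by (simp add: \<zeta>_def power_divide mult.commute flip: power_mult)
    qed simp
    also have "\<dots> = of_nat n * (A ^\<^sub>m k) $$ (u, v)"
      by (rule fourier_inversion[OF \<omega> inj uv(2), where f = "\<lambda>b. (A ^\<^sub>m k) $$ (u, b)"])
    finally show ?thesis using zero by simp
  qed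
  \<comment> \<open>The class of \<open>\<mu> 0\<close> contains the index 0, so it is nonempty and
    must be everything.\<close>
  then have "(\<Sum>j\<in>{j\<in>{..<n}. \<mu> j = \<mu> 0}. \<zeta> ^ j) = 0"
    by (rule separate_value_class[OF finite_lessThan])
  then have "{j\<in>{..<n}. \<mu> j = \<mu> 0} = {..<n}"
    using n0 by (intro vanishing_sum_roots_of_unity[OF p \<zeta>]) auto
  then have const: "\<mu> j = \<mu> 0" if "j < n" for j using that by blast
  have "\<omega> ^ d \<noteq> 1" using inj_onD[OF inj, of d 0] d by auto
  then have geom: "(\<Sum>j<n. (1 / \<omega> ^ d) ^ j) = 0"
    by (intro sum_powers_root_of_unity) (simp_all add: power_divide \<omega>jn \<omega>0)
  have "of_nat n * h d = (\<Sum>j<n. \<mu> j / (\<omega> ^ d) ^ j)"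
    unfolding \<mu>_def by (rule fourier_inversion[OF \<omega> inj d(2), where f = h, symmetric])
  also have "\<dots> = (\<Sum>j<n. \<mu> 0 * (1 / \<omega> ^ d) ^ j)"
  proof (rule sum.cong)
    fix j assume "j \<in> {..<n}"
    then have "\<mu> j = \<mu> 0" by (intro const) simp
    then show "\<mu> j / (\<omega> ^ d) ^ j = \<mu> 0 * (1 / \<omega> ^ d) ^ j" by (simp add: power_divide)
  qed simp
  also have "\<dots> = \<mu> 0 * (\<Sum>j<n. (1 / \<omega> ^ d) ^ j)"
    by (simp add: sum_distrib_left)
  also have "\<dots> = 0" using geom by simp
  finally show ?thesis using n0 by simp
qed

section \<open>From zero transfer to vanishing entries of matrix powers\<close>

text \<open>If the coefficients below \<open>m\<close> vanish, dividing by \<open>x ^ m\<close>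
  leaves a series with value \<open>a m\<close> at 0. By continuity this is the limit of its zero
  values at positive reals.\<close>

lemma powser_zero_on_nonneg_reals:
  fixes a :: "nat \<Rightarrow> complex"
  assumes sums: "\<And>t::real. t \<ge> 0 \<Longrightarrow> (\<lambda>k. a k * of_real t ^ k) sums 0"
  shows "a m = 0"
proof (induction m rule: less_induct)
  case (less m)
  have shift: "(\<lambda>k. a (k + m) * x ^ k) sums (s / x ^ m)" if "x \<noteq> 0" "(\<lambda>k. a k * x ^ k) sums s" for x s
  proof -
    have "(\<lambda>k. a (k + m) * x ^ (k + m)) sums s"
      using sums_iff_shift[of "\<lambda>k. a k * x ^ k" m s] that less by simp
    then have "(\<lambda>k. a (k + m) * x ^ (k + m) / x ^ m) sums (s / x ^ m)"
      by (rule sums_divide)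
    then show ?thesis using that by (simp add: power_add)
  qed
  define f where "f x = (\<Sum>k. a (k + m) * x ^ k)" for x
  have "(f \<longlongrightarrow> a (0 + m)) (at 0)"
  proof (rule powser_limit_0_strong[of 1])
    fix x :: complex assume x: "x \<noteq> 0" "norm x < 1"
    \<comment> \<open>Convergence at 1 gives convergence in the open unit disc, as the complex limit
      at 0 requires.\<close>
    have "summable (\<lambda>k. a k * x ^ k)"
      using powser_inside[of a 1 x] sums[of 1] x by (auto simp: sums_iff)
    then show "(\<lambda>k. a (k + m) * x ^ k) sums f x"
      unfolding f_def by (intro summable_sums sums_summable[OF shift[OF x(1) summable_sums]])
  qed simp
  moreover have "filterlim (\<lambda>i. complex_of_real (1 / real (Suc i))) (at 0) sequentially"
  proof (rule filterlim_atI)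
    show "(\<lambda>i. complex_of_real (1 / real (Suc i))) \<longlonglongrightarrow> 0"
      using tendsto_of_real[OF LIMSEQ_inverse_real_of_nat, where 'a = complex]
      by (simp add: inverse_eq_divide)
  qed (auto intro!: always_eventually simp flip: of_nat_Suc)
  ultimately have "(\<lambda>i. f (complex_of_real (1 / real (Suc i)))) \<longlonglongrightarrow> a (0 + m)"
    by (rule filterlim_compose)
  moreover have "f (complex_of_real (1 / real (Suc i))) = 0" for i
    unfolding f_def using shift[of "complex_of_real (1 / real (Suc i))" 0] sums[of "1 / real (Suc i)"]
    by (simp add: sums_iff flip: of_nat_Suc del: of_real_divide)
  ultimately show ?case by (simp add: LIMSEQ_const_iff)
qed

lemma pow_smult_mat:
  fixes A :: "'a::comm_ring_1 mat"
  assumes A: "A \<in> carrier_mat n n"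
  shows "(c \<cdot>\<^sub>m A) ^\<^sub>m k = c ^ k \<cdot>\<^sub>m (A ^\<^sub>m k)"
proof (induction k)
  case 0
  show ?case using A by (intro eq_matI) auto
next
  case (Suc k)
  have "A ^\<^sub>m k \<in> carrier_mat n n" using A by (rule pow_carrier_mat)
  then have "(c ^ k \<cdot>\<^sub>m A ^\<^sub>m k) * (c \<cdot>\<^sub>m A) = c \<cdot>\<^sub>m (c ^ k \<cdot>\<^sub>m (A ^\<^sub>m k * A))"
    using A by (simp add: mult_smult_distrib[of _ n n _ n] mult_smult_assoc_mat[of _ n n _ n])
  also have "\<dots> = (c * c ^ k) \<cdot>\<^sub>m (A ^\<^sub>m k * A)"
    by (rule eq_matI) (simp_all add: mult.assoc)
  finally have "(c ^ k \<cdot>\<^sub>m A ^\<^sub>m k) * (c \<cdot>\<^sub>m A) = (c * c ^ k) \<cdot>\<^sub>m (A ^\<^sub>m k * A)" .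
  then show ?case using Suc by simp
qed

text \<open>The entry of the transition matrix is a power series in \<open>t\<close>; its
  coefficients \<open>a k\<close> are nonzero multiples of the entries of the powers.\<close>

lemma zero_transfer_imp_power_entry_0:
  assumes uv: "u < n" "v < n" and zt: "zero_transfer n C u v"
  shows "(hermitian_adj n C ^\<^sub>m k) $$ (u, v) = 0"
proof -
  let ?H = "hermitian_adj n C"
  have H: "?H \<in> carrier_mat n n" by (simp add: hermitian_adj_def)
  define a where "a k = (- \<i>) ^ k * (?H ^\<^sub>m k) $$ (u, v) / fact k" for k
  have "(\<lambda>k. a k * of_real t ^ k) sums 0" if t: "t \<ge> 0" for t
  proof -
    let ?A = "(- \<i> * complex_of_real t) \<cdot>\<^sub>m ?H"
    have A: "?A \<in> carrier_mat n n" using H by simp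
    have "(?A ^\<^sub>m k) $$ (u, v) / fact k = a k * of_real t ^ k" for k
      using carrier_matD[OF pow_carrier_mat[OF H, of k]] uv
      unfolding pow_smult_mat[OF H] power_mult_distrib by (simp add: a_def)
    moreover have "(\<Sum>k. (?A ^\<^sub>m k) $$ (u, v) / fact k) = 0"
      using zt t uv H unfolding zero_transfer_def transition_matrix_def mat_exp_def by simp
    ultimately show ?thesis
      using summable_mat_exp[OF A uv] by (simp add: sums_iff)
  qed
  then have "a k = 0" by (rule powser_zero_on_nonneg_reals)
  then show ?thesis by (simp add: a_def)
qed

section \<open>Connectedness and the final contradiction\<close>

text \<open>Without arcs the symmetric closure has only trivial reachability, so the distinct
  vertices 0 and 1 cannot be joined.\<close>

lemma connected_circulant_imp_nonempty:
  assumes n: "n > 1" and conn: "Digraph_Component.connected (with_proj (circulant_graph n C))"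
  shows "C \<noteq> {}"
proof
  assume "C = {}"
  then have E: "arcs_ends (mk_symmetric (with_proj (circulant_graph n C))) = {}"
    by (auto simp: circulant_graph_def mk_symmetric_def arcs_ends_def arc_to_ends_def)
  have "0 \<rightarrow>\<^sup>*\<^bsub>with_proj (mk_symmetric (with_proj (circulant_graph n C)))\<^esub> 1"
    using conn n unfolding connected_def strongly_connected_def
    by (simp add: mk_symmetric_def circulant_graph_def)
  then have "(0, 1) \<in> rtrancl_on {0..<n} {}"
    unfolding reachable_def E by (simp add: mk_symmetric_def circulant_graph_def)
  then have "(0::nat) = 1" by (cases rule: rtrancl_on.cases) auto
  then show False by simp
qed

theorem theorem4p1:
  fixes n :: nat and C :: "nat set"
  assumes "prime n"
    and "oriented_connection_set n C"
    and "Digraph_Component.connected (with_proj (circulant_graph n C))"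
  shows "\<not> (\<exists>u \<in> pverts (circulant_graph n C). \<exists>v \<in> pverts (circulant_graph n C).
              u \<noteq> v \<and> zero_transfer n C u v)"
proof
  assume "\<exists>u \<in> pverts (circulant_graph n C). \<exists>v \<in> pverts (circulant_graph n C).
              u \<noteq> v \<and> zero_transfer n C u v"
  then obtain u v where uv: "u < n" "v < n" "u \<noteq> v" and zt: "zero_transfer n C u v"
    by (auto simp: circulant_graph_def)
  \<comment> \<open>The Hermitian adjacency entry as a function of the difference
    \<open>d = b - a\<close> alone; the test on \<open>a - b\<close> becomes one on
    \<open>- d\<close>.\<close>
  define h where "h d = (if d \<in> C then \<i> else if zdiff n 0 d \<in> C then - \<i> else 0)" for d
  have "C \<noteq> {}"
    using assms(1,3) connected_circulant_imp_nonempty prime_gt_1_nat by blast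
  then obtain c where c: "c \<in> C" "0 < c" "c < n"
    using assms(2) by (fastforce simp: oriented_connection_set_def)
  have "h c = 0"
  proof (rule circulant_prime_vanishing_powers_entry[OF assms(1) _ _ uv])
    show "hermitian_adj n C \<in> carrier_mat n n" by (simp add: hermitian_adj_def)
    show "(hermitian_adj n C ^\<^sub>m k) $$ (u, v) = 0" for k
      using uv zt by (intro zero_transfer_imp_power_entry_0)
    show "hermitian_adj n C $$ (a, b) = h (zdiff n b a)" if "a < n" "b < n" for a b
    proof -
      have "zdiff n 0 (zdiff n b a) = zdiff n a b"
        using that by (simp add: zdiff_def mod_minus_eq)
      then show ?thesis using that by (simp add: hermitian_adj_def h_def)
    qed
  qed (use c in auto)
  \<comment> \<open>A connection element \<open>c\<close> has \<open>h c = \<i>\<close>, which is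
    not 0.\<close>
  then show False using c by (simp add: h_def)
qed

end
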